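(* Let $P$ and $Q$ be rational $d$-polytopes in $\mathbb R^d$. If $\mathrm{ehr}_{P+\bm v}(t)=\mathrm{ehr}_{Q+\bm v}(t)$ for all $\bm v\in\mathbb Q^d$ and all $t\in\mathbb Z_{\ge0}$, then $P=Q+\bm u$ for some $\bm u\in\mathbb Z^d$. Equivalently: if $\mathrm{TL}_{P,\bm v}(t)=\mathrm{TL}_{Q,\bm v}(t)$ for all $\bm v\in\mathbb R^d$ and $t\in\mathbb Z_{\ge0}$, then $P=Q+\bm w$ for some $\bm w\in\mathbb Z^d$.
   Context: $\mathrm{ehr}_X(t)=\#(tX\cap\mathbb Z^d)$ and $\mathrm{TL}_{X,\bm v}(t)=\#((tX+\bm v)\cap\mathbb Z^d)$ for $t\in\mathbb Z_{\ge0}$; $X+\bm v=\{\bm x+\bm v:\bm x\in X\}$. *)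

theory Defs
  imports "HOL-Analysis.Analysis"
begin

definition lattice_points :: "(real^'n) set" where
  "lattice_points = {x. \<forall>i. x $ i \<in> \<int>}"

definition rational_points :: "(real^'n) set" where
  "rational_points = {x. \<forall>i. x $ i \<in> \<rat>}"

definition rational_polytope :: "(real^'n) set \<Rightarrow> bool" where
  "rational_polytope P \<longleftrightarrow>
     (\<exists>S. finite S \<and> S \<subseteq> rational_points \<and> P = convex hull S)"

definition full_dim :: "(real^'n) set \<Rightarrow> bool" where
  "full_dim P \<longleftrightarrow> aff_dim P = int CARD('n)"

definition ehr :: "(real^'n) set \<Rightarrow> nat \<Rightarrow> nat" where
  "ehr X t = card ((\<lambda>x. real t *\<^sub>R x) ` X \<inter> lattice_points)"

definition translate :: "(real^'n) set \<Rightarrow> real^'n \<Rightarrow> (real^'n) set" where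
  "translate X v = (\<lambda>x. x + v) ` X"

end

theory Submission
  imports Defs
begin

text \<open>
  Only the dilation factor \<open>t = 1\<close> is needed. Let \<open>N X y\<close> count the lattice points \<open>z\<close> with \<open>z + y \<in> X\<close>.
  If \<open>N P = N Q\<close> at rational points then also at real points, by perturbing within the rational
  relations that hold among vertices and lattice points.

  If compact convex sets satisfy a linear relation between their indicator functions, then the
  coefficients of the nonempty sets sum to zero (existence of the Euler characteristic). Applied to local
  sections of \<open>P\<close> and \<open>Q\<close> this shows that \<open>N P = N Q\<close> is inherited by the faces on which a linear functional
  \<open>c\<close> attains its maximum. By induction on the dimension these faces agree up to an integer
  translation \<open>u c\<close>. As faces for functionals near \<open>c\<close> are contained in the face for \<open>c\<close>, the map \<open>u\<close> is locally
  constant, hence constant on the punctured space of directions if this space has dimension at least two,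
  and then \<open>P = Q + u\<close>. In dimension one, aligning one endpoint makes one set contain the other, and strict
  containment is impossible when \<open>N\<close> agrees.
\<close>

subsection \<open>The Euler relation for compact convex sets\<close>

text \<open>Taking inner products with \<open>b\<close> maps each nonempty \<open>A i\<close> onto a
  compact interval \<open>[l i, r i]\<close>, and the slice at \<open>t\<close> is nonempty exactly
  when \<open>t\<close> lies in it. Every interval has one right endpoint, so it suffices that the
  weights of the intervals ending at any given point cancel.\<close>

lemma euler_relation_from_slices:
  fixes A :: "'i \<Rightarrow> 'a::euclidean_space set" and a :: "'i \<Rightarrow> int"
  assumes fin: "finite I"
    and A: "\<And>i. i \<in> I \<Longrightarrow> compact (A i) \<and> convex (A i)"
    and slices: "\<And>t. sum a {i\<in>I. A i \<inter> {x. b \<bullet> x = t} \<noteq> {}} = 0"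
  shows "sum a {i\<in>I. A i \<noteq> {}} = 0"
proof -
  define J where "J = {i\<in>I. A i \<noteq> {}}"
  have finJ: "finite J"
    using fin by (simp add: J_def)
  have "\<forall>i\<in>J. \<exists>x. x \<in> A i \<and> (\<forall>y\<in>A i. b \<bullet> y \<le> b \<bullet> x)"
  proof
    fix i assume i: "i \<in> J"
    have "continuous_on (A i) ((\<bullet>) b)"
      by (intro continuous_intros)
    with i A[of i] continuous_attains_sup[of "A i" "(\<bullet>) b"]
    show "\<exists>x. x \<in> A i \<and> (\<forall>y\<in>A i. b \<bullet> y \<le> b \<bullet> x)"
      by (auto simp: J_def)
  qed
  then obtain xr where xr: "\<And>i. i \<in> J \<Longrightarrow> xr i \<in> A i"
    "\<And>i y. i \<in> J \<Longrightarrow> y \<in> A i \<Longrightarrow> b \<bullet> y \<le> b \<bullet> xr i"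
    by metis
  have "\<forall>i\<in>J. \<exists>x. x \<in> A i \<and> (\<forall>y\<in>A i. b \<bullet> x \<le> b \<bullet> y)"
  proof
    fix i assume i: "i \<in> J"
    have "continuous_on (A i) ((\<bullet>) b)"
      by (intro continuous_intros)
    with i A[of i] continuous_attains_inf[of "A i" "(\<bullet>) b"]
    show "\<exists>x. x \<in> A i \<and> (\<forall>y\<in>A i. b \<bullet> x \<le> b \<bullet> y)"
      by (auto simp: J_def)
  qed
  then obtain xl where xl: "\<And>i. i \<in> J \<Longrightarrow> xl i \<in> A i"
    "\<And>i y. i \<in> J \<Longrightarrow> y \<in> A i \<Longrightarrow> b \<bullet> xl i \<le> b \<bullet> y"
    by metis
  define l r where "l i = b \<bullet> xl i" and "r i = b \<bullet> xr i" for i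
  have lr: "l i \<le> r i" if "i \<in> J" for i
    using xl xr that by (simp add: l_def r_def)
  have slice_eq: "{i\<in>I. A i \<inter> {x. b \<bullet> x = t} \<noteq> {}} = {i\<in>J. l i \<le> t \<and> t \<le> r i}" for t
  proof -
    have "A i \<inter> {x. b \<bullet> x = t} \<noteq> {}" if "i \<in> J" "l i \<le> t" "t \<le> r i" for i
    proof -
      have "connected (A i)"
        using A that by (auto simp: J_def intro: convex_connected)
      from connected_ivt_hyperplane[OF this xl(1) xr(1)] show ?thesis
        using that by (auto simp: l_def r_def)
    qed
    moreover have "i \<in> J \<and> l i \<le> t \<and> t \<le> r i"
      if "i \<in> I" "A i \<inter> {x. b \<bullet> x = t} \<noteq> {}" for i
    proof -
      from that obtain x where x: "x \<in> A i" "b \<bullet> x = t"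
        by blast
      then have "i \<in> J"
        using that by (auto simp: J_def)
      then show ?thesis
        using xl(2) xr(2) x by (auto simp: l_def r_def)
    qed
    ultimately show ?thesis
      by (auto simp: J_def)
  qed
  have sum_slice: "sum a {i\<in>J. l i \<le> t \<and> t \<le> r i} = 0" for t
    using slices[of t] by (simp add: slice_eq)
  txt \<open>The intervals containing \<open>s\<close> but not the points just to its right are those ending at \<open>s\<close>.\<close>
  have endpoint: "sum a {i\<in>J. r i = s} = 0" for s
  proof -
    have ev: "\<forall>\<^sub>F t in at_right s. (l i \<le> t \<and> t \<le> r i) = (l i \<le> s \<and> s < r i)" for i
    proof -
      have gt: "\<forall>\<^sub>F t in at_right s. s < t"
        by (rule eventually_at_right_less)
      have lt: "s < c \<Longrightarrow> \<forall>\<^sub>F t in at_right s. t < c" for c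
        by (rule order_tendstoD[OF tendsto_ident_at])
      consider "l i > s" | "l i \<le> s" "r i > s" | "r i \<le> s"
        by linarith
      then show ?thesis
      proof cases
        case 1
        from lt[OF 1] show ?thesis by eventually_elim (use 1 in auto)
      next
        case 2
        from lt[OF 2(2)] gt show ?thesis by eventually_elim (use 2 in auto)
      next
        case 3
        from gt show ?thesis by eventually_elim (use 3 in auto)
      qed
    qed
    \<comment> \<open>As \<open>J\<close> is finite, a single \<open>t\<close> to the right of
      \<open>s\<close> serves all intervals at once.\<close>
    have "\<forall>\<^sub>F t in at_right s. \<forall>i\<in>J. (l i \<le> t \<and> t \<le> r i) = (l i \<le> s \<and> s < r i)"
      using finJ ev by (simp add: eventually_ball_finite)
    then obtain t where "\<forall>i\<in>J. (l i \<le> t \<and> t \<le> r i) = (l i \<le> s \<and> s < r i)"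
      using eventually_happens'[OF trivial_limit_at_right_real] by blast
    then have t: "{i\<in>J. l i \<le> t \<and> t \<le> r i} = {i\<in>J. l i \<le> s \<and> s < r i}"
      by blast
    have "{i\<in>J. l i \<le> s \<and> s \<le> r i} = {i\<in>J. l i \<le> s \<and> s < r i} \<union> {i\<in>J. r i = s}"
      using lr by auto
    moreover have "{i\<in>J. l i \<le> s \<and> s < r i} \<inter> {i\<in>J. r i = s} = {}"
      by auto
    ultimately have "sum a {i\<in>J. l i \<le> s \<and> s \<le> r i}
        = sum a {i\<in>J. l i \<le> s \<and> s < r i} + sum a {i\<in>J. r i = s}"
      using finJ by (simp add: sum.union_disjoint)
    then show ?thesis
      using sum_slice[of s] sum_slice[of t] by (simp add: t)
  qed
  have "sum a J = (\<Sum>s\<in>r ` J. sum a {i\<in>J. r i = s})"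
    using finJ by (intro sum.group[symmetric]) auto
  then show ?thesis
    by (simp add: endpoint flip: J_def)
qed

text \<open>Induction on the set \<open>B\<close> of coordinates in which the sets may still spread
  out. Slicing at a fixed value of a coordinate removes it from \<open>B\<close> and keeps the
  pointwise relation. With no coordinate left, all nonempty sets are one and the same singleton,
  where the pointwise relation is the claim.\<close>

lemma euler_relation_aux:
  fixes A :: "'i \<Rightarrow> 'a::euclidean_space set" and a :: "'i \<Rightarrow> int"
  assumes fin: "finite I" and "finite B"
    and "\<And>i. i \<in> I \<Longrightarrow> compact (A i) \<and> convex (A i)"
    and "\<And>x. sum a {i\<in>I. x \<in> A i} = 0"
    and "\<And>i j x y b. i \<in> I \<Longrightarrow> j \<in> I \<Longrightarrow> x \<in> A i \<Longrightarrow> y \<in> A j \<Longrightarrow> b \<in> Basis - B \<Longrightarrow> b \<bullet> x = b \<bullet> y"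
  shows "sum a {i\<in>I. A i \<noteq> {}} = 0"
  using assms(2-)
proof (induction B arbitrary: A rule: finite_induct)
  case empty
  show ?case
  proof (cases "\<exists>i\<in>I. A i \<noteq> {}")
    case True
    then obtain k x where k: "k \<in> I" "x \<in> A k"
      by blast
    have "y = x" if "i \<in> I" "y \<in> A i" for i y
      using empty.prems(3)[OF that(1) k(1) that(2) k(2)]
      by (subst euclidean_eq_iff) (simp add: inner_commute)
    then have "A i \<noteq> {} \<longleftrightarrow> x \<in> A i" if "i \<in> I" for i
      using that by (metis ex_in_conv)
    then have "{i\<in>I. A i \<noteq> {}} = {i\<in>I. x \<in> A i}"
      by (simp cong: conj_cong)
    then show ?thesis
      using empty.prems(2) by simp
  next
    case False
    then have "{i\<in>I. A i \<noteq> {}} = {}" by blast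
    then show ?thesis by (simp only: sum.empty)
  qed
next
  case (insert b B)
  show ?case
  proof (rule euler_relation_from_slices[where b = b, OF fin insert.prems(1)])
    fix t
    show "sum a {i\<in>I. A i \<inter> {x. b \<bullet> x = t} \<noteq> {}} = 0"
    proof (rule insert.IH)
      show "compact (A i \<inter> {x. b \<bullet> x = t}) \<and> convex (A i \<inter> {x. b \<bullet> x = t})" if "i \<in> I" for i
        using insert.prems(1)[OF that]
        by (auto intro: compact_Int_closed closed_hyperplane convex_Int convex_hyperplane)
      show "sum a {i\<in>I. x \<in> A i \<inter> {x. b \<bullet> x = t}} = 0" for x
        using insert.prems(2)[of x] by (cases "b \<bullet> x = t") auto
      show "c \<bullet> x = c \<bullet> y" if "i \<in> I" "j \<in> I" "x \<in> A i \<inter> {x. b \<bullet> x = t}"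
        "y \<in> A j \<inter> {x. b \<bullet> x = t}" "c \<in> Basis - B" for i j x y c
        using that insert.prems(3)[of i j x y c] by (cases "c = b") auto
    qed
  qed
qed

lemma euler_relation:
  fixes A :: "'i \<Rightarrow> 'a::euclidean_space set" and a :: "'i \<Rightarrow> int"
  assumes "finite I"
    and "\<And>i. i \<in> I \<Longrightarrow> compact (A i) \<and> convex (A i)"
    and "\<And>x. sum a {i\<in>I. x \<in> A i} = 0"
  shows "sum a {i\<in>I. A i \<noteq> {}} = 0"
  by (rule euler_relation_aux[of I Basis]) (use assms in auto)

text \<open>The two families are joined into one over the disjoint sum of the index sets, with
  weight 1 on the first and -1 on the second.\<close>

lemma euler_relation_card:
  fixes A :: "'i \<Rightarrow> 'a::euclidean_space set" and B :: "'j \<Rightarrow> 'a set"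
  assumes "finite I" "finite J"
    and A: "\<And>i. i \<in> I \<Longrightarrow> compact (A i) \<and> convex (A i)"
    and B: "\<And>j. j \<in> J \<Longrightarrow> compact (B j) \<and> convex (B j)"
    and eq: "\<And>x. card {i\<in>I. x \<in> A i} = card {j\<in>J. x \<in> B j}"
  shows "card {i\<in>I. A i \<noteq> {}} = card {j\<in>J. B j \<noteq> {}}"
proof -
  let ?C = "case_sum A B" and ?a = "case_sum (\<lambda>_. 1) (\<lambda>_. - 1) :: 'i + 'j \<Rightarrow> int"
  have split: "sum ?a {k \<in> I <+> J. Q (?C k)} = int (card {i\<in>I. Q (A i)}) - int (card {j\<in>J. Q (B j)})"
    for Q :: "'a set \<Rightarrow> bool"
  proof -
    have "{k \<in> I <+> J. Q (?C k)} = {i\<in>I. Q (A i)} <+> {j\<in>J. Q (B j)}"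
      by (auto simp: Plus_def)
    then show ?thesis
      using assms(1,2) by (simp add: sum.Plus)
  qed
  have "sum ?a {k \<in> I <+> J. ?C k \<noteq> {}} = 0"
  proof (rule euler_relation)
    show "compact (?C k) \<and> convex (?C k)" if "k \<in> I <+> J" for k
      using that A B by auto
    show "sum ?a {k \<in> I <+> J. x \<in> ?C k} = 0" for x
      using eq[of x] by (simp add: split[of "\<lambda>S. x \<in> S"])
  qed (use assms in auto)
  then show ?thesis
    by (simp add: split[of "\<lambda>S. S \<noteq> {}"])
qed

subsection \<open>Rational perturbation\<close>

text \<open>Regard the reals as a vector space over the rationals with a Hamel basis containing 1,
  and move each basis element to a nearby rational. The elements of \<open>T\<close> have finitely
  many coordinates in total, so the errors on \<open>T\<close> stay controlled.\<close>

lemma rational_linear_approximation: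
  fixes T :: "real set" and e :: real
  assumes T: "finite T" and e: "0 < e"
  obtains \<phi> :: "real \<Rightarrow> real"
  where "\<And>x y. \<phi> (x + y) = \<phi> x + \<phi> y"
    and "\<And>q x. q \<in> \<rat> \<Longrightarrow> \<phi> (q * x) = q * \<phi> x"
    and "\<phi> 1 = 1"
    and "\<And>x. \<phi> x \<in> \<rat>"
    and "\<And>t. t \<in> T \<Longrightarrow> \<bar>\<phi> t - t\<bar> < e"
proof -
  let ?s = "\<lambda>(q::rat) (x::real). of_rat q * x"
  interpret V: vector_space ?s
    by unfold_locales (simp_all add: algebra_simps of_rat_add of_rat_mult)
  interpret VP: vector_space_pair ?s ?s
    by unfold_locales
  define B where "B = V.extend_basis {1}"
  have ind1: "V.independent {1}"
    by (simp add: V.independent_insert)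
  have B: "1 \<in> B" "V.independent B" "V.span B = UNIV"
    using V.extend_basis_superset[OF ind1] V.independent_extend_basis[OF ind1]
      V.span_extend_basis[OF ind1] by (auto simp: B_def)
  let ?R = "V.representation B"
  \<comment> \<open>\<open>M\<close> bounds the sum of the absolute coordinates of every
    \<open>t\<close> in \<open>T\<close>, so an error below \<open>d\<close> on the basis costs at
    most \<open>M * d\<close> on \<open>T\<close>. The denominator \<open>M + 1\<close> makes this
    strictly less than \<open>e\<close>, also when \<open>M = 0\<close>.\<close>
  define M where "M = (\<Sum>t\<in>T. \<Sum>b | ?R t b \<noteq> 0. \<bar>real_of_rat (?R t b)\<bar>)"
  have M: "0 \<le> M"
    by (simp add: M_def sum_nonneg)
  define d where "d = e / (M + 1)"
  have d: "0 < d"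
    using e M by (simp add: d_def)
  have "\<exists>q\<in>\<rat>. \<bar>q - b\<bar> < d" for b :: real
  proof -
    obtain q where "q \<in> \<rat>" "b < q" "q < b + d"
      using Rats_dense_in_real[of b "b + d"] d by auto
    then show ?thesis
      by (intro bexI[of _ q]) auto
  qed
  then obtain g0 where g0: "\<And>b. g0 b \<in> \<rat>" "\<And>b. \<bar>g0 b - b\<bar> < d"
    by metis
  \<comment> \<open>Fixing 1 makes \<phi> the identity on the rationals.\<close>
  define g where "g b = (if b = 1 then 1 else g0 b)" for b
  have g: "g b \<in> \<rat>" "\<bar>g b - b\<bar> < d" for b
    using g0 d by (auto simp: g_def)
  define \<phi> where "\<phi> = VP.construct B g"
  interpret L: Vector_Spaces.linear ?s ?s \<phi>
    unfolding \<phi>_def by (rule VP.linear_construct[OF B(2)])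
  have \<phi>B: "\<phi> b = g b" if "b \<in> B" for b
    unfolding \<phi>_def by (rule VP.construct_basis[OF B(2) that])
  have expand: "t = (\<Sum>b | ?R t b \<noteq> 0. of_rat (?R t b) * b)" for t
    using V.sum_nonzero_representation_eq[OF B(2), of t] B(3) by simp
  have RB: "b \<in> B" if "?R t b \<noteq> 0" for t b
    using V.representation_ne_zero that by blast
  have \<phi>_expand: "\<phi> t = (\<Sum>b | ?R t b \<noteq> 0. of_rat (?R t b) * g b)" for t
  proof -
    have "\<phi> t = \<phi> (\<Sum>b | ?R t b \<noteq> 0. of_rat (?R t b) * b)"
      using expand[of t] by simp
    also have "\<dots> = (\<Sum>b | ?R t b \<noteq> 0. of_rat (?R t b) * \<phi> b)"
      by (simp add: L.sum L.scale)
    also have "\<dots> = (\<Sum>b | ?R t b \<noteq> 0. of_rat (?R t b) * g b)"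
      using RB \<phi>B by (intro sum.cong) auto
    finally show ?thesis .
  qed
  show thesis
  proof
    show "\<phi> (x + y) = \<phi> x + \<phi> y" for x y
      by (rule L.add)
    show "\<phi> (q * x) = q * \<phi> x" if "q \<in> \<rat>" for q x
      using that L.scale by (auto elim!: Rats_cases)
    show "\<phi> 1 = 1"
      using \<phi>B[OF B(1)] by (simp add: g_def)
    show "\<phi> x \<in> \<rat>" for x
      unfolding \<phi>_expand using g(1) by (intro Rats_sum Rats_mult) auto
    show "\<bar>\<phi> t - t\<bar> < e" if "t \<in> T" for t
    proof -
      have "\<phi> t - t = (\<Sum>b | ?R t b \<noteq> 0. of_rat (?R t b) * (g b - b))"
        unfolding right_diff_distrib sum_subtractf by (simp only: \<phi>_expand flip: expand)
      then have "\<bar>\<phi> t - t\<bar> \<le> (\<Sum>b | ?R t b \<noteq> 0. \<bar>of_rat (?R t b) * (g b - b)\<bar>)"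
        by (simp only: sum_abs)
      also have "\<dots> \<le> (\<Sum>b | ?R t b \<noteq> 0. \<bar>real_of_rat (?R t b)\<bar> * d)"
        unfolding abs_mult using g(2) by (intro sum_mono mult_left_mono less_imp_le) auto
      also have "\<dots> = (\<Sum>b | ?R t b \<noteq> 0. \<bar>real_of_rat (?R t b)\<bar>) * d"
        by (simp add: sum_distrib_right)
      also have "\<dots> \<le> M * d"
        unfolding M_def using T that d
        by (intro mult_right_mono member_le_sum[where f = "\<lambda>t. \<Sum>b | ?R t b \<noteq> 0. \<bar>real_of_rat (?R t b)\<bar>"])
          (auto intro: sum_nonneg)
      also have "\<dots> < e"
        using M e by (simp add: d_def field_simps)
      finally show ?thesis .
    qed
  qed
qed

text \<open>
  A rational-linear map from the reals to the rationals, close to the identity, is applied to \<open>y\<close> and to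
  all coefficients of the convex combinations. The relations between them have rational coefficients and
  are preserved; zero coefficients stay zero and positive ones stay positive.
\<close>

lemma convex_hull_rational_perturbation:
  fixes S :: "(real^'n) set" and y :: "real^'n"
  assumes S: "finite S" "S \<subseteq> rational_points" and Z: "finite Z" "Z \<subseteq> rational_points"
    and hull: "\<And>z. z \<in> Z \<Longrightarrow> z + y \<in> convex hull S" and e: "0 < e"
  obtains y' where "y' \<in> rational_points" "dist y' y < e" "\<And>z. z \<in> Z \<Longrightarrow> z + y' \<in> convex hull S"
proof -
  have "\<forall>z\<in>Z. \<exists>u. (\<forall>x\<in>S. 0 \<le> u x) \<and> sum u S = 1 \<and> (\<Sum>x\<in>S. u x *\<^sub>R x) = z + y"
    using hull S(1) by (simp add: convex_hull_finite)
  from bchoice[OF this] obtain u where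
    "\<forall>z\<in>Z. (\<forall>x\<in>S. 0 \<le> u z x) \<and> sum (u z) S = 1 \<and> (\<Sum>x\<in>S. u z x *\<^sub>R x) = z + y"
    by (elim exE) simp
  then have u: "\<And>z x. z \<in> Z \<Longrightarrow> x \<in> S \<Longrightarrow> 0 \<le> u z x"
    "\<And>z. z \<in> Z \<Longrightarrow> sum (u z) S = 1"
    "\<And>z. z \<in> Z \<Longrightarrow> (\<Sum>x\<in>S. u z x *\<^sub>R x) = z + y"
    by simp_all
  define U where "U = case_prod u ` (Z \<times> S)"
  \<comment> \<open>An error below the least positive coefficient preserves positivity. The other
    bound, summed over all coordinates, moves \<open>y\<close> by less than
    \<open>e\<close>.\<close>
  define d where "d = Min (insert (e / (CARD('n) + 1)) {t \<in> U. 0 < t})"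
  have finU: "finite U"
    using S Z by (simp add: U_def)
  have d: "0 < d" "d \<le> e / (CARD('n) + 1)" "\<And>t. t \<in> U \<Longrightarrow> 0 < t \<Longrightarrow> d \<le> t"
    using finU e by (auto simp: d_def add_pos_pos)
  have "finite (U \<union> range (($) y))"
    using finU by simp
  then obtain \<phi> where \<phi>: "\<And>x y. \<phi> (x + y) = \<phi> x + \<phi> y"
    "\<And>q x. q \<in> \<rat> \<Longrightarrow> \<phi> (q * x) = q * \<phi> x" "\<phi> 1 = 1" "\<And>x. \<phi> x \<in> \<rat>"
    "\<And>t. t \<in> U \<union> range (($) y) \<Longrightarrow> \<bar>\<phi> t - t\<bar> < d"
    using d(1) by (rule rational_linear_approximation) blast
  have \<phi>0: "\<phi> 0 = 0"
    using \<phi>(2)[of 0 0] by simp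
  have \<phi>_rat: "\<phi> q = q" if "q \<in> \<rat>" for q
    using \<phi>(2)[of q 1] \<phi>(3) that by simp
  have \<phi>_sum: "\<phi> (sum f A) = (\<Sum>x\<in>A. \<phi> (f x))" for f and A :: "(real^'n) set"
    by (induction A rule: infinite_finite_induct) (auto simp: \<phi>0 \<phi>(1))
  define y' where "y' = (\<chi> i. \<phi> (y $ i))"
  show thesis
  proof
    show "y' \<in> rational_points"
      by (simp add: rational_points_def y'_def \<phi>(4))
    have "dist y' y \<le> (\<Sum>i\<in>UNIV. \<bar>(y' - y) $ i\<bar>)"
      unfolding dist_norm by (rule norm_le_l1_cart)
    also have "\<dots> \<le> (\<Sum>i\<in>(UNIV::'n set). d)"
      using \<phi>(5) by (intro sum_mono) (auto simp: y'_def intro: less_imp_le)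
    also have "\<dots> \<le> CARD('n) * (e / (CARD('n) + 1))"
      unfolding sum_constant using d(2) by (intro mult_left_mono) auto
    also have "\<dots> < e"
      using e by (simp add: field_simps)
    finally show "dist y' y < e" .
    show "z + y' \<in> convex hull S" if z: "z \<in> Z" for z
    proof -
      have nonneg: "0 \<le> \<phi> (u z x)" if x: "x \<in> S" for x
      proof (cases "u z x = 0")
        case False
        have "u z x \<in> U"
          using x z by (auto simp: U_def)
        moreover have "0 < u z x"
          using False u(1)[OF z x] by simp
        ultimately show ?thesis
          using d(3)[of "u z x"] \<phi>(5)[of "u z x"] by fastforce
      qed (simp add: \<phi>0)
      have one: "(\<Sum>x\<in>S. \<phi> (u z x)) = 1"
        using \<phi>_sum[of "u z" S] u(2)[OF z] \<phi>(3) by simp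
      have comb: "(\<Sum>x\<in>S. \<phi> (u z x) *\<^sub>R x) = z + y'"
      proof (subst vec_eq_iff, intro allI)
        fix i
        have "(\<Sum>x\<in>S. \<phi> (u z x) *\<^sub>R x) $ i = (\<Sum>x\<in>S. \<phi> (x $ i * u z x))"
          using S(2) by (auto simp: \<phi>(2) rational_points_def mult.commute intro!: sum.cong)
        also have "\<dots> = \<phi> ((\<Sum>x\<in>S. u z x *\<^sub>R x) $ i)"
          by (simp add: \<phi>_sum mult.commute)
        also have "\<dots> = (z + y') $ i"
          using z Z(2) by (auto simp: u(3) \<phi>(1) y'_def rational_points_def \<phi>_rat)
        finally show "(\<Sum>x\<in>S. \<phi> (u z x) *\<^sub>R x) $ i = (z + y') $ i" .
      qed
      show ?thesis
        unfolding convex_hull_finite[OF S(1)] using nonneg one comb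
        by (intro CollectI exI[of _ "\<lambda>x. \<phi> (u z x)"]) auto
    qed
  qed
qed

subsection \<open>Counting lattice points in translates\<close>

text \<open>Equivalently, the number of points of \<open>X\<close> in the coset of the lattice
  through \<open>y\<close>.\<close>

definition lattice_count :: "(real^'n) set \<Rightarrow> real^'n \<Rightarrow> nat" where
  "lattice_count X y = card {z \<in> lattice_points. z + y \<in> X}"

lemma lattice_points_0 [simp]: "0 \<in> lattice_points"
  by (simp add: lattice_points_def)

lemma lattice_points_add: "x \<in> lattice_points \<Longrightarrow> y \<in> lattice_points \<Longrightarrow> x + y \<in> lattice_points"
  by (simp add: lattice_points_def)

lemma lattice_points_uminus: "x \<in> lattice_points \<Longrightarrow> - x \<in> lattice_points"
  by (simp add: lattice_points_def)

lemma lattice_points_rational: "lattice_points \<subseteq> rational_points"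
  by (auto simp: lattice_points_def rational_points_def intro: subsetD[OF Ints_subset_Rats])

lemma finite_bounded_lattice:
  fixes X :: "(real^'n) set"
  assumes "bounded X"
  shows "finite (lattice_points \<inter> X)"
proof -
  obtain r where r: "\<And>x. x \<in> X \<Longrightarrow> norm x \<le> r"
    using assms by (auto simp: bounded_iff)
  define K where "K = {k::int. \<bar>real_of_int k\<bar> \<le> r}"
  have "K \<subseteq> {- \<lceil>r\<rceil>..\<lceil>r\<rceil>}"
    by (auto simp: K_def abs_le_iff) linarith+
  then have "finite K"
    by (rule finite_subset) simp
  then have "finite ((\<lambda>g. (\<chi> i. real_of_int (g i)) :: real^'n) ` (UNIV \<rightarrow>\<^sub>E K))"
    by (intro finite_imageI finite_PiE) auto
  moreover have "lattice_points \<inter> X \<subseteq> (\<lambda>g. (\<chi> i. real_of_int (g i))) ` (UNIV \<rightarrow>\<^sub>E K)"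
  proof
    fix x :: "real^'n"
    assume x: "x \<in> lattice_points \<inter> X"
    have fl: "real_of_int \<lfloor>x $ i\<rfloor> = x $ i" for i
      using x by (simp add: lattice_points_def)
    have "\<bar>x $ i\<bar> \<le> r" for i
      using component_le_norm_cart[of x i] r[of x] x by simp
    then have mem: "(\<lambda>i. \<lfloor>x $ i\<rfloor>) \<in> UNIV \<rightarrow>\<^sub>E K"
      by (auto simp: K_def fl)
    have "(\<chi> i. real_of_int \<lfloor>x $ i\<rfloor>) = x"
      by (simp add: vec_eq_iff fl)
    then show "x \<in> (\<lambda>g. (\<chi> i. real_of_int (g i))) ` (UNIV \<rightarrow>\<^sub>E K)"
      using imageI[OF mem, of "\<lambda>g. \<chi> i. real_of_int (g i)"] by (simp only:)
  qed
  ultimately show ?thesis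
    by (rule finite_subset[rotated])
qed

lemma finite_lattice_translate:
  fixes X :: "(real^'n) set"
  assumes "bounded X"
  shows "finite {z \<in> lattice_points. z + y \<in> X}"
proof -
  have "{z \<in> lattice_points. z + y \<in> X} = lattice_points \<inter> ((+) (- y)) ` X"
    by (force simp: image_iff)
  then show ?thesis
    using finite_bounded_lattice[OF bounded_translation[OF assms]] by (simp only:)
qed

text \<open>Moving \<open>y\<close> by less than 1 brings only points of
  \<open>cball 0 (r + 1)\<close> into \<open>X\<close>. Finitely many lattice translates
  \<open>z + y\<close> lie in that ball outside \<open>X\<close>, and each stays in the open
  complement under a small move.\<close>

lemma eventually_no_new_lattice_points:
  fixes X :: "(real^'n) set"
  assumes "compact X"
  shows "\<forall>\<^sub>F y' in nhds y. \<forall>z\<in>lattice_points. z + y' \<in> X \<longrightarrow> z + y \<in> X"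
proof -
  obtain r where r: "\<And>x. x \<in> X \<Longrightarrow> norm x \<le> r"
    using compact_imp_bounded[OF assms] by (auto simp: bounded_iff)
  define Z where "Z = {z \<in> lattice_points. z + y \<in> cball 0 (r + 1) - X}"
  have "finite Z"
    unfolding Z_def by (rule finite_lattice_translate) (simp add: bounded_diff)
  moreover have "\<forall>\<^sub>F y' in nhds y. z + y' \<in> - X" if "z \<in> Z" for z
  proof (rule topological_tendstoD)
    show "((\<lambda>y'. z + y') \<longlongrightarrow> z + y) (nhds y)"
      by (intro tendsto_add tendsto_const filterlim_ident)
    show "open (- X)"
      using assms by (simp add: compact_imp_closed open_Compl)
    show "z + y \<in> - X"
      using that by (simp add: Z_def)
  qed
  ultimately have "\<forall>\<^sub>F y' in nhds y. \<forall>z\<in>Z. z + y' \<in> - X"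
    by (simp add: eventually_ball_finite)
  moreover have "\<forall>\<^sub>F y' in nhds y. dist y' y < 1"
    unfolding eventually_nhds_metric by (intro exI[of _ 1]) simp
  ultimately show ?thesis
  proof eventually_elim
    case (elim y')
    show ?case
    proof (intro ballI impI)
      fix z assume z: "z \<in> lattice_points" "z + y' \<in> X"
      have "norm (z + y) \<le> norm (z + y') + norm (y - y')"
        using norm_triangle_ineq[of "z + y'" "y - y'"] by (simp add: algebra_simps)
      also have "\<dots> \<le> r + 1"
        using r[OF z(2)] elim(2) by (simp add: dist_norm norm_minus_commute)
      finally show "z + y \<in> X"
        using z elim(1) by (auto simp: Z_def)
    qed
  qed
qed

lemma lattice_count_usc:
  fixes X :: "(real^'n) set"
  assumes "compact X"
  shows "\<forall>\<^sub>F y' in nhds y. lattice_count X y' \<le> lattice_count X y"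
  using eventually_no_new_lattice_points[OF assms]
proof eventually_elim
  case (elim y')
  then show ?case
    unfolding lattice_count_def
    by (intro card_mono finite_lattice_translate compact_imp_bounded assms) auto
qed

text \<open>A rational \<open>y'\<close> near \<open>y\<close> can keep every lattice translate that
  lies in \<open>P\<close>, so the count for \<open>P\<close> does not drop from \<open>y\<close> to
  \<open>y'\<close>. By upper semicontinuity the count for \<open>Q\<close> does not rise.\<close>

lemma lattice_count_le_if_rational:
  fixes P Q :: "(real^'n) set"
  assumes P: "rational_polytope P" and Q: "compact Q"
    and le: "\<And>v. v \<in> rational_points \<Longrightarrow> lattice_count P v \<le> lattice_count Q v"
  shows "lattice_count P y \<le> lattice_count Q y"
proof -
  obtain S where S: "finite S" "S \<subseteq> rational_points" "P = convex hull S"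
    using P by (auto simp: rational_polytope_def)
  have bP: "bounded P"
    using S by (simp add: finite_imp_bounded bounded_convex_hull)
  define Z where "Z = {z \<in> lattice_points. z + y \<in> P}"
  obtain e where e: "0 < e" "\<And>y'. dist y' y < e \<Longrightarrow> lattice_count Q y' \<le> lattice_count Q y"
    using lattice_count_usc[OF Q, of y] by (auto simp: eventually_nhds_metric)
  have hull: "z + y \<in> convex hull S" if "z \<in> Z" for z
    using that by (simp add: Z_def S(3))
  have "finite Z"
    unfolding Z_def by (rule finite_lattice_translate[OF bP])
  moreover have "Z \<subseteq> rational_points"
    using lattice_points_rational by (auto simp: Z_def)
  ultimately obtain y' where y': "y' \<in> rational_points" "dist y' y < e"
    "\<And>z. z \<in> Z \<Longrightarrow> z + y' \<in> convex hull S"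
    by (rule convex_hull_rational_perturbation[OF S(1,2) _ _ hull e(1)]; blast)
  have "lattice_count P y \<le> lattice_count P y'"
    unfolding lattice_count_def
    by (intro card_mono finite_lattice_translate[OF bP]) (use y'(3) S(3) in \<open>auto simp: Z_def\<close>)
  also have "\<dots> \<le> lattice_count Q y'"
    by (rule le[OF y'(1)])
  also have "\<dots> \<le> lattice_count Q y"
    by (rule e(2)[OF y'(2)])
  finally show ?thesis .
qed

lemma ehr_translate_1: "ehr (translate X v) 1 = lattice_count X (- v)"
proof -
  have "(\<lambda>x. real 1 *\<^sub>R x) ` translate X v \<inter> lattice_points = {z \<in> lattice_points. z + - v \<in> X}"
    by (force simp: translate_def image_iff)
  then show ?thesis
    by (simp add: ehr_def lattice_count_def)
qed

subsection \<open>Exposed faces\<close>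

definition exposed_face :: "'a::euclidean_space \<Rightarrow> 'a set \<Rightarrow> 'a set" where
  "exposed_face c X = {x \<in> X. \<forall>y\<in>X. c \<bullet> y \<le> c \<bullet> x}"

lemma exposed_face_subset: "exposed_face c X \<subseteq> X"
  by (auto simp: exposed_face_def)

lemma exposed_face_nonempty:
  assumes "compact X" "X \<noteq> {}"
  shows "exposed_face c X \<noteq> {}"
proof -
  have "continuous_on X ((\<bullet>) c)"
    by (intro continuous_intros)
  from continuous_attains_sup[OF assms this] show ?thesis
    by (auto simp: exposed_face_def)
qed

lemma exposed_face_eq_Int:
  assumes "m \<in> exposed_face c X"
  shows "exposed_face c X = X \<inter> {x. c \<bullet> x = c \<bullet> m}"
  using assms by (force simp: exposed_face_def)

lemma exposed_face_face_of:
  assumes "convex X"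
  shows "exposed_face c X face_of X"
proof (cases "exposed_face c X = {}")
  case False
  then obtain m where m: "m \<in> exposed_face c X"
    by blast
  then have "X \<inter> {x. c \<bullet> x = c \<bullet> m} face_of X"
    using assms by (intro face_of_Int_supporting_hyperplane_le) (auto simp: exposed_face_def)
  then show ?thesis
    by (simp add: exposed_face_eq_Int[OF m])
qed simp

lemma exposed_face_translate: "exposed_face c (translate X u) = translate (exposed_face c X) u"
  by (auto simp: exposed_face_def translate_def inner_add_right)

text \<open>
  Near each lattice translate \<open>z + y\<close> in \<open>X\<close>, cut \<open>X\<close> with a small ball and with the hyperplane at height
  \<open>h\<close> above \<open>z + y\<close> in direction \<open>c\<close>. For small \<open>h > 0\<close> this section \<open>A X h z\<close> is empty precisely when
  \<open>z + y\<close> lies on the face, while the indicator functions of the sections have the same sum for \<open>P\<close> and \<open>Q\<close>.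
\<close>

lemma lattice_count_exposed_face:
  fixes P Q :: "(real^'n) set"
  assumes P: "compact P" "convex P" and Q: "compact Q" "convex Q"
    and eq: "\<And>y. lattice_count P y = lattice_count Q y"
  shows "lattice_count (exposed_face c P) y = lattice_count (exposed_face c Q) y"
proof -
  \<comment> \<open>For shifts \<open>v\<close> of norm at most \<open>d\<close>, every lattice
    point counted at \<open>y + v\<close> is already counted at \<open>y\<close>. Hence the finite
    sets \<open>Z X\<close> below suffice as index sets.\<close>
  obtain d where d: "0 < d"
    "\<And>X v z. X \<in> {P, Q} \<Longrightarrow> norm v \<le> d \<Longrightarrow> z \<in> lattice_points \<Longrightarrow> z + (y + v) \<in> X \<Longrightarrow> z + y \<in> X"
  proof -
    have "\<forall>\<^sub>F y' in nhds y. \<forall>X\<in>{P, Q}. \<forall>z\<in>lattice_points. z + y' \<in> X \<longrightarrow> z + y \<in> X"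
      using eventually_no_new_lattice_points P(1) Q(1) by (intro eventually_ball_finite) auto
    then obtain e where e: "0 < e" "\<And>y' X z. dist y' y < e \<Longrightarrow> X \<in> {P, Q} \<Longrightarrow>
        z \<in> lattice_points \<Longrightarrow> z + y' \<in> X \<Longrightarrow> z + y \<in> X"
      unfolding eventually_nhds_metric by blast
    have "z + y \<in> X" if "X \<in> {P, Q}" "norm v \<le> e / 2" "z \<in> lattice_points" "z + (y + v) \<in> X" for X v z
      by (rule e(2)[of "y + v"]) (use that e(1) in \<open>auto simp: dist_norm\<close>)
    then show thesis
      using e(1) by (intro that[of "e / 2"]) auto
  qed
  define Z where "Z X = {z \<in> lattice_points. z + y \<in> X}" for X
  define A where "A X h z = {v. z + (y + v) \<in> X} \<inter> cball 0 d \<inter> {v. c \<bullet> v = h}" for X h z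
  have finZ: "finite (Z X)" if "X \<in> {P, Q}" for X
    using that P(1) Q(1) by (auto simp: Z_def intro!: finite_lattice_translate compact_imp_bounded)
  have A: "compact (A X h z) \<and> convex (A X h z)" if X: "X \<in> {P, Q}" for X h z
  proof -
    have "{v. z + (y + v) \<in> X} = (+) (- (z + y)) ` X"
      by (force simp: image_iff algebra_simps)
    moreover have "compact ((+) (- (z + y)) ` X)" "convex ((+) (- (z + y)) ` X)"
      using X P Q by (auto intro: compact_translation simp del: image_add_0)
    ultimately show ?thesis
      by (auto simp: A_def intro!: compact_Int_closed closed_hyperplane convex_Int convex_hyperplane)
  qed
  have empty: "A X h z = {}" if "z + y \<in> exposed_face c X" "0 < h" for X h z
    using that by (force simp: A_def exposed_face_def inner_add_right)
  have ev: "\<forall>\<^sub>F h in at_right 0. \<forall>z\<in>Z X. z + y \<notin> exposed_face c X \<longrightarrow> A X h z \<noteq> {}"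
    if X: "X \<in> {P, Q}" for X
  proof (intro eventually_ball_finite finZ[OF X] ballI)
    fix z assume z: "z \<in> Z X"
    show "\<forall>\<^sub>F h in at_right 0. z + y \<notin> exposed_face c X \<longrightarrow> A X h z \<noteq> {}"
    proof (cases "z + y \<in> exposed_face c X")
      case False
      with z obtain p where p: "p \<in> X" "c \<bullet> (z + y) < c \<bullet> p"
        by (auto simp: Z_def exposed_face_def not_le)
      define w where "w = p - (z + y)"
      have w: "0 < c \<bullet> w"
        using p(2) by (simp add: w_def inner_diff_right)
      then have "0 < norm w"
        by auto
      \<comment> \<open>The segment from \<open>z + y\<close> to \<open>p\<close> reaches height
        \<open>h\<close> at the fraction \<open>h / (c \<bullet> w)\<close>. The first bound keeps
        this fraction below 1, the second keeps the displacement within the ball of radius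
        \<open>d\<close>.\<close>
      then have "0 < min (c \<bullet> w) (d * (c \<bullet> w) / norm w)"
        using w d(1) by simp
      then have "\<forall>\<^sub>F h in at_right 0. h < min (c \<bullet> w) (d * (c \<bullet> w) / norm w)"
        by (rule order_tendstoD[OF tendsto_ident_at])
      moreover have "\<forall>\<^sub>F h::real in at_right 0. 0 < h"
        by (rule eventually_at_right_less)
      ultimately show ?thesis
      proof eventually_elim
        case (elim h)
        let ?s = "h / (c \<bullet> w)"
        have s: "0 \<le> ?s" "?s \<le> 1"
          using elim w by auto
        have "(1 - ?s) *\<^sub>R (z + y) + ?s *\<^sub>R p \<in> X"
          using X P Q p(1) z s by (intro convexD_alt) (auto simp: Z_def)
        moreover have "(1 - ?s) *\<^sub>R (z + y) + ?s *\<^sub>R p = z + (y + ?s *\<^sub>R w)"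
          by (simp add: w_def algebra_simps)
        moreover have "norm (?s *\<^sub>R w) \<le> d"
          using elim w \<open>0 < norm w\<close> by (simp add: field_simps)
        moreover have "c \<bullet> (?s *\<^sub>R w) = h"
          using w by simp
        ultimately have "?s *\<^sub>R w \<in> A X h z"
          by (simp add: A_def)
        then show ?case
          by blast
      qed
    qed simp
  qed
  have "\<forall>\<^sub>F h::real in at_right 0. 0 < h"
    by (rule eventually_at_right_less)
  with ev[of P] ev[of Q] have "\<forall>\<^sub>F h in at_right 0. 0 < h \<and> (\<forall>X\<in>{P, Q}. \<forall>z\<in>Z X.
      z + y \<notin> exposed_face c X \<longrightarrow> A X h z \<noteq> {})"
    by (simp add: eventually_conj_iff)
  then obtain h where h: "0 < h"
    "\<And>X z. X \<in> {P, Q} \<Longrightarrow> z \<in> Z X \<Longrightarrow> z + y \<notin> exposed_face c X \<Longrightarrow> A X h z \<noteq> {}"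
    using eventually_happens'[OF trivial_limit_at_right_real] by blast
  have "card {z \<in> Z P. v \<in> A P h z} = card {z \<in> Z Q. v \<in> A Q h z}" for v
  proof (cases "norm v \<le> d \<and> c \<bullet> v = h")
    case True
    have "{z \<in> Z X. v \<in> A X h z} = {z \<in> lattice_points. z + (y + v) \<in> X}" if "X \<in> {P, Q}" for X
      using True d(2)[OF that] by (auto simp: Z_def A_def)
    then show ?thesis
      using eq[of "y + v"] by (simp add: lattice_count_def)
  next
    case False
    then have none: "{z \<in> Z X. v \<in> A X h z} = {}" for X
      by (auto simp: A_def)
    show ?thesis
      by (simp only: none)
  qed
  then have off: "card {z \<in> Z P. A P h z \<noteq> {}} = card {z \<in> Z Q. A Q h z \<noteq> {}}"
    by (intro euler_relation_card finZ A) auto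
  \<comment> \<open>The lattice translates in \<open>X\<close> split into those with a nonempty
    section and those on the face. The totals agree for \<open>P\<close> and \<open>Q\<close>, and
    so do the first parts by \<open>off\<close>, hence also the face counts.\<close>
  have "card (Z X) = card {z \<in> Z X. A X h z \<noteq> {}} + lattice_count (exposed_face c X) y"
    if X: "X \<in> {P, Q}" for X
  proof -
    define F N where "F = {z \<in> lattice_points. z + y \<in> exposed_face c X}"
      and "N = {z \<in> Z X. A X h z \<noteq> {}}"
    have ZX: "Z X = N \<union> F"
      using h(2)[OF X] exposed_face_subset[of c X] by (auto simp: Z_def F_def N_def)
    have "N \<inter> F = {}"
      using empty[OF _ h(1)] by (auto simp: F_def N_def)
    then have "card (Z X) = card N + card F"
      using finZ[OF X] unfolding ZX by (intro card_Un_disjoint) auto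
    then show ?thesis
      by (simp add: lattice_count_def F_def N_def)
  qed
  from this[of P] this[of Q] off eq[of y] show ?thesis
    by (simp add: Z_def lattice_count_def)
qed

section \<open>Translates and their lattice counts\<close>

lemma translate_eq_empty_iff [simp]: "translate X u = {} \<longleftrightarrow> X = {}"
  by (simp add: translate_def)

lemma translate_eq_translation: "translate X u = (+) u ` X"
  by (simp add: translate_def add.commute)

lemma mem_translate_iff: "x \<in> translate X u \<longleftrightarrow> x - u \<in> X"
  by (force simp: translate_def image_iff)

lemma compact_translate: "compact X \<Longrightarrow> compact (translate X u)"
  unfolding translate_eq_translation by (rule compact_translation)

lemma convex_translate: "convex X \<Longrightarrow> convex (translate X u)"
  unfolding translate_eq_translation by (rule convex_translation)

lemma lattice_count_translate:
  assumes "u \<in> lattice_points"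
  shows "lattice_count (translate X u) y = lattice_count X y"
  unfolding lattice_count_def
proof (rule bij_betw_same_card)
  show "bij_betw (\<lambda>z. z - u) {z \<in> lattice_points. z + y \<in> translate X u} {z \<in> lattice_points. z + y \<in> X}"
  proof (rule bij_betw_byWitness[where f' = "\<lambda>z. z + u"])
    show "(\<lambda>z. z - u) ` {z \<in> lattice_points. z + y \<in> translate X u} \<subseteq> {z \<in> lattice_points. z + y \<in> X}"
      using lattice_points_add[OF _ lattice_points_uminus[OF assms]]
      by (auto simp: mem_translate_iff diff_add_eq)
    show "(\<lambda>z. z + u) ` {z \<in> lattice_points. z + y \<in> X} \<subseteq> {z \<in> lattice_points. z + y \<in> translate X u}"
      using lattice_points_add[OF _ assms] by (auto simp: mem_translate_iff algebra_simps)
  qed auto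
qed

text \<open>At a point \<open>y\<close> of \<open>Y - X\<close> the lattice point 0 is counted for
  \<open>Y\<close> only.\<close>

lemma lattice_count_psubset:
  assumes "bounded Y" "X \<subset> Y"
  shows "\<exists>y. lattice_count X y < lattice_count Y y"
proof -
  obtain y where y: "y \<in> Y" "y \<notin> X"
    using assms(2) by blast
  have "{z \<in> lattice_points. z + y \<in> X} \<subset> {z \<in> lattice_points. z + y \<in> Y}"
  proof (rule psubsetI)
    show "{z \<in> lattice_points. z + y \<in> X} \<noteq> {z \<in> lattice_points. z + y \<in> Y}"
      using y lattice_points_0 by (auto simp: set_eq_iff intro!: exI[of _ 0])
  qed (use assms(2) in auto)
  then show ?thesis
    unfolding lattice_count_def
    by (intro exI[of _ y] psubset_card_mono finite_lattice_translate assms(1))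
qed

text \<open>A point of \<open>X\<close> that is maximal in direction \<open>u - v\<close> would
  remain in \<open>X\<close> after being pushed further by \<open>u - v\<close>.\<close>

lemma translate_unique:
  assumes "compact X" "X \<noteq> {}" "translate X u = translate X v"
  shows "u = v"
proof -
  obtain m where m: "m \<in> exposed_face (u - v) X"
    using exposed_face_nonempty[OF assms(1,2)] by blast
  then have "m + u \<in> translate X v"
    using assms(3) by (auto simp: exposed_face_def translate_def)
  then have "m + (u - v) \<in> X"
    by (simp add: mem_translate_iff algebra_simps)
  with m have "(u - v) \<bullet> (m + (u - v)) \<le> (u - v) \<bullet> m"
    by (simp add: exposed_face_def)
  then have "(u - v) \<bullet> (u - v) \<le> 0"
    by (simp add: inner_add_right)
  then show ?thesis
    by (metis inner_ge_zero inner_eq_zero_iff order_antisym right_minus_eq)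
qed

section \<open>Faces in nearby directions and comparison of sets through their faces\<close>

lemma exposed_face_antimono:
  assumes "exposed_face c' X \<subseteq> exposed_face c X" "X \<noteq> {}" "compact X"
  shows "exposed_face c' (exposed_face c X) = exposed_face c' X"
proof -
  obtain m where m: "m \<in> exposed_face c' X"
    using exposed_face_nonempty[OF assms(3,2)] by blast
  then have "m \<in> exposed_face c X"
    using assms(1) by blast
  then show ?thesis
    using m assms(1) unfolding exposed_face_def by (auto intro: order_trans)
qed

text \<open>The finitely many strict inequalities that \<open>c\<close> induces between generators
  persist for \<open>c'\<close> near \<open>c\<close>. So a generator maximal for \<open>c'\<close>
  is maximal for \<open>c\<close>, and each face is the hull of the generators it contains.\<close>

lemma eventually_exposed_face_subset:
  fixes P :: "'a::euclidean_space set"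
  assumes "polytope P"
  shows "\<forall>\<^sub>F c' in nhds c. exposed_face c' P \<subseteq> exposed_face c P"
proof -
  obtain S where S: "finite S" "P = convex hull S"
    using assms by (auto simp: polytope_def)
  have "convex P" "compact P"
    using S by (simp_all add: finite_imp_compact_convex_hull)
  have SP: "s \<in> P" if "s \<in> S" for s
    using that S hull_inc by simp
  have "\<forall>\<^sub>F c' in nhds c. \<forall>x\<in>S. \<forall>y\<in>S. c \<bullet> x < c \<bullet> y \<longrightarrow> c' \<bullet> x < c' \<bullet> y"
  proof (intro eventually_ball_finite S(1) ballI)
    fix x y
    show "\<forall>\<^sub>F c' in nhds c. c \<bullet> x < c \<bullet> y \<longrightarrow> c' \<bullet> x < c' \<bullet> y"
    proof (cases "c \<bullet> x < c \<bullet> y")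
      case True
      have "((\<lambda>c'. c' \<bullet> y - c' \<bullet> x) \<longlongrightarrow> c \<bullet> y - c \<bullet> x) (nhds c)"
        by (intro tendsto_diff tendsto_inner tendsto_const filterlim_ident)
      from order_tendstoD(1)[OF this, of 0] True show ?thesis
        by (simp add: eventually_mono)
    qed simp
  qed
  then show ?thesis
  proof eventually_elim
    case (elim c')
    obtain S' where S': "S' \<subseteq> S" "exposed_face c' P = convex hull S'"
      using face_of_convex_hull_subset[OF finite_imp_compact[OF S(1)]]
        exposed_face_face_of[OF \<open>convex P\<close>, of c'] S(2) by metis
    have "S' \<subseteq> exposed_face c P"
    proof
      fix s assume s: "s \<in> S'"
      have "s \<in> exposed_face c' P"
        using s S'(2) hull_inc by metis
      then have max: "c' \<bullet> x \<le> c' \<bullet> s" if "x \<in> P" for x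
        using that by (simp add: exposed_face_def)
      have "S \<subseteq> {x. c \<bullet> x \<le> c \<bullet> s}"
      proof
        fix x assume x: "x \<in> S"
        show "x \<in> {x. c \<bullet> x \<le> c \<bullet> s}"
          using elim max[OF SP[OF x]] x s S'(1) by (force simp: not_less[symmetric])
      qed
      then have "P \<subseteq> {x. c \<bullet> x \<le> c \<bullet> s}"
        unfolding S(2) by (intro hull_minimal convex_halfspace_le)
      then show "s \<in> exposed_face c P"
        using SP s S'(1) by (auto simp: exposed_face_def)
    qed
    then show ?case
      unfolding S'(2)
      using exposed_face_face_of[OF \<open>convex P\<close>, of c] by (intro hull_minimal face_of_imp_convex)
  qed
qed

lemma polytope_exposed_face:
  assumes "polytope P"
  shows "polytope (exposed_face c P)"
  using assms exposed_face_face_of face_of_polytope_polytope polytope_imp_convex by blast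

text \<open>If \<open>x\<close> in \<open>P\<close> were outside \<open>R\<close>, a separating
  functional, projected to \<open>L\<close>, would be smaller on all of \<open>R\<close> than at
  \<open>x\<close>. Yet its maximum over \<open>P\<close> is attained on a face shared with
  \<open>R\<close>.\<close>

lemma subset_if_exposed_faces_eq:
  fixes P R :: "'a::euclidean_space set"
  assumes P: "compact P" "P \<noteq> {}" and R: "closed R" "convex R"
    and L: "subspace L" "L \<noteq> {0}"
    and dir: "\<And>x y. x \<in> P \<Longrightarrow> y \<in> P \<Longrightarrow> x - y \<in> L" "\<And>x y. x \<in> R \<Longrightarrow> y \<in> R \<Longrightarrow> x - y \<in> L"
    and eq: "\<And>c. c \<in> L - {0} \<Longrightarrow> exposed_face c P = exposed_face c R"
  shows "P \<subseteq> R"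
proof (rule ccontr)
  assume "\<not> P \<subseteq> R"
  then obtain x where x: "x \<in> P" "x \<notin> R"
    by blast
  obtain a b where ab: "a \<bullet> x < b" "\<And>y. y \<in> R \<Longrightarrow> b < a \<bullet> y"
    using separating_hyperplane_closed_point[OF R(2,1) x(2)] by blast
  \<comment> \<open>The normal \<open>- a\<close> may leave \<open>L\<close>. Its part
    \<open>z\<close> orthogonal to \<open>L\<close> is constant on \<open>P \<union> R\<close>,
    since both sets have differences in \<open>L\<close> and share the point \<open>p\<close>; so
    \<open>c\<close> alone still separates.\<close>
  obtain c z where cz: "c \<in> L" "\<And>w. w \<in> L \<Longrightarrow> orthogonal z w" "- a = c + z"
    using orthogonal_subspace_decomp_exists[of L "- a"] span_eq_iff[of L] L(1) by metis
  obtain c0 where c0: "c0 \<in> L - {0}"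
    using L subspace_0 by blast
  obtain p where "p \<in> exposed_face c0 P"
    using exposed_face_nonempty[OF P] by blast
  then have p: "p \<in> P" "p \<in> R"
    using eq[OF c0] exposed_face_subset by blast+
  have z: "z \<bullet> y = z \<bullet> p" if "y \<in> P \<union> R" for y
    using that cz(2)[of "y - p"] dir(1)[of y p] dir(2)[of y p] p
    by (auto simp: orthogonal_def inner_diff_right)
  have less: "c \<bullet> y < c \<bullet> x" if "y \<in> R" for y
  proof -
    have "- a \<bullet> y < - a \<bullet> x"
      using ab(1) ab(2)[OF that] by simp
    then show ?thesis
      unfolding cz(3) using z[of x] z[of y] x(1) that by (simp add: inner_add_left)
  qed
  have "c \<noteq> 0"
    using less[OF p(2)] by auto
  then have c: "c \<in> L - {0}"
    using cz(1) by blast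
  obtain m where m: "m \<in> exposed_face c P"
    using exposed_face_nonempty[OF P] by blast
  then have "m \<in> R"
    using eq[OF c] exposed_face_subset by blast
  then show False
    using less[of m] m x(1) by (simp add: exposed_face_def not_less[symmetric])
qed

text \<open>Both sets are segments on one line with a common upper end \<open>p\<close>, so the one
  reaching lower in direction \<open>e\<close> contains the other.\<close>

lemma collinear_common_exposed_face:
  fixes P R :: "'a::euclidean_space set"
  assumes P: "compact P" "P \<noteq> {}" "convex P" and R: "compact R" "R \<noteq> {}" "convex R"
    and dir: "\<And>x y. x \<in> P \<Longrightarrow> y \<in> P \<Longrightarrow> x - y \<in> span {e}"
      "\<And>x y. x \<in> R \<Longrightarrow> y \<in> R \<Longrightarrow> x - y \<in> span {e}"
    and eq: "exposed_face e P = exposed_face e R"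
  shows "P \<subseteq> R \<or> R \<subseteq> P"
proof -
  obtain p where "p \<in> exposed_face e P"
    using exposed_face_nonempty[OF P(1,2)] by blast
  then have p: "p \<in> P" "p \<in> R" "\<And>x. x \<in> P \<union> R \<Longrightarrow> e \<bullet> x \<le> e \<bullet> p"
    using eq by (auto simp: exposed_face_def)
  have sub: "X \<subseteq> Y" if XY: "X \<subseteq> P \<union> R" "p \<in> X" "p \<in> Y" "convex Y" "r \<in> Y" "\<And>x. x \<in> X \<Longrightarrow> e \<bullet> r \<le> e \<bullet> x"
    "\<And>x. x \<in> X \<Longrightarrow> x - p \<in> span {e}" "r - p \<in> span {e}" for X Y r
  proof
    fix x assume x: "x \<in> X"
    obtain s t where st: "x - p = s *\<^sub>R e" "r - p = t *\<^sub>R e"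
      using XY(7)[OF x] XY(8) by (auto simp: span_singleton)
    show "x \<in> Y"
    proof (cases "x = p")
      case False
      then have e: "0 < e \<bullet> e" "s \<noteq> 0"
        using st(1) by auto
      have "e \<bullet> (x - p) \<le> 0" "e \<bullet> (r - p) \<le> e \<bullet> (x - p)"
        using p(3)[of x] x XY(1,6) by (auto simp: inner_diff_right)
      then have "s * (e \<bullet> e) \<le> 0" "t * (e \<bullet> e) \<le> s * (e \<bullet> e)"
        unfolding st by simp_all
      then have "s < 0" "t \<le> s"
        using e by (auto simp: mult_le_0_iff)
      \<comment> \<open>\<open>x\<close> lies at the fraction \<open>s / t\<close> of the way from
        \<open>p\<close> to \<open>r\<close>, hence in the convex set \<open>Y\<close>.\<close>
      then have "0 \<le> s / t" "s / t \<le> 1"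
        by (auto simp: divide_simps)
      then have "(1 - s / t) *\<^sub>R p + (s / t) *\<^sub>R r \<in> Y"
        using XY by (intro convexD_alt)
      moreover have "(1 - s / t) *\<^sub>R p + (s / t) *\<^sub>R r = p + (s / t) *\<^sub>R (r - p)"
        by (simp add: algebra_simps)
      moreover have "p + (s / t) *\<^sub>R (r - p) = x"
        using \<open>s < 0\<close> \<open>t \<le> s\<close> st by (simp add: algebra_simps)
      ultimately show ?thesis
        by simp
    qed (use XY in simp)
  qed
  obtain q where "q \<in> exposed_face (- e) P"
    using exposed_face_nonempty[OF P(1,2)] by blast
  then have q: "q \<in> P" "\<And>x. x \<in> P \<Longrightarrow> e \<bullet> q \<le> e \<bullet> x"
    by (auto simp: exposed_face_def)
  obtain r where "r \<in> exposed_face (- e) R"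
    using exposed_face_nonempty[OF R(1,2)] by blast
  then have r: "r \<in> R" "\<And>x. x \<in> R \<Longrightarrow> e \<bullet> r \<le> e \<bullet> x"
    by (auto simp: exposed_face_def)
  show ?thesis
  proof (cases "e \<bullet> r \<le> e \<bullet> q")
    case True
    then have "P \<subseteq> R"
      using q(2) by (intro sub[of P R r]) (use p r R dir in \<open>auto intro: order_trans\<close>)
    then show ?thesis ..
  next
    case False
    then have "R \<subseteq> P"
      using r(2) by (intro sub[of R P q]) (use p q P dir in \<open>auto intro: order_trans[of _ "e \<bullet> r"]\<close>)
    then show ?thesis ..
  qed
qed

subsection \<open>Induction on the dimension\<close>

lemma polytope_determined_by_lattice_count:
  fixes P Q :: "(real^'n) set"
  assumes "polytope P" "P \<noteq> {}" "polytope Q" "Q \<noteq> {}"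
    and "\<And>y. lattice_count P y = lattice_count Q y"
  shows "\<exists>u \<in> lattice_points. P = translate Q u"
  using assms
proof (induction "nat (aff_dim P + aff_dim Q)" arbitrary: P Q rule: less_induct)
  case less
  have aff_dim_nonneg: "0 \<le> aff_dim X" if "X \<noteq> {}" for X :: "(real^'n) set"
    using that aff_dim_negative_iff[of X] by (simp add: not_less[symmetric])
  have P: "polytope P" "P \<noteq> {}" "convex P" "compact P" "0 \<le> aff_dim P"
    using less.prems by (auto simp: polytope_imp_convex polytope_imp_compact aff_dim_nonneg)
  have Q: "polytope Q" "Q \<noteq> {}" "convex Q" "compact Q" "0 \<le> aff_dim Q"
    using less.prems by (auto simp: polytope_imp_convex polytope_imp_compact aff_dim_nonneg)
  note eq = less.prems(5)
  \<comment> \<open>A strict inclusion would change the count at some point, while an integer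
    translation preserves all counts.\<close>
  have done_if_comparable: ?case
    if u: "u \<in> lattice_points" "P \<subseteq> translate Q u \<or> translate Q u \<subseteq> P" for u
  proof (rule bexI[OF _ u(1)], rule ccontr)
    assume "P \<noteq> translate Q u"
    then have "P \<subset> translate Q u \<or> translate Q u \<subset> P"
      using u(2) by blast
    then obtain y where "lattice_count P y \<noteq> lattice_count (translate Q u) y"
      using lattice_count_psubset[of "translate Q u" P] lattice_count_psubset[of P "translate Q u"]
        P(4) compact_translate[OF Q(4), of u] by (metis compact_imp_bounded less_irrefl)
    then show False
      by (simp add: lattice_count_translate[OF u(1)] eq)
  qed
  \<comment> \<open>\<open>L\<close> is the joint direction space of \<open>P\<close> and
    \<open>Q\<close>. It contains the functionals that matter: a nonzero \<open>c\<close> in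
    \<open>L\<close> is not orthogonal to all of \<open>D\<close>, so it is nonconstant on
    \<open>P\<close> or on \<open>Q\<close>.\<close>
  define D where "D = (\<lambda>(x, y). x - y) ` (P \<times> P) \<union> (\<lambda>(x, y). x - y) ` (Q \<times> Q)"
  define L where "L = span D"
  have L: "subspace L"
    by (simp add: L_def)
  have dirP: "x - y \<in> L" if "x \<in> P" "y \<in> P" for x y
    using that by (auto simp: L_def D_def intro!: span_base)
  have dirQ: "x - y \<in> L" if "x \<in> Q" "y \<in> Q" for x y
    using that by (auto simp: L_def D_def intro!: span_base)
  have dirT: "x - y \<in> L" if "x \<in> translate Q u" "y \<in> translate Q u" for x y u
    using that dirQ by (auto simp: translate_def)
  \<comment> \<open>At least one of the two faces is proper, so the sum of the dimensions drops and
    the induction hypothesis applies.\<close>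
  have faces: "\<exists>u\<in>lattice_points. exposed_face c P = translate (exposed_face c Q) u"
    if c: "c \<in> L - {0}" for c
  proof (rule less.hyps)
    have "exposed_face c P \<noteq> P \<or> exposed_face c Q \<noteq> Q"
    proof (rule ccontr)
      assume "\<not> ?thesis"
      then have *: "exposed_face c P = P" "exposed_face c Q = Q"
        by auto
      have const: "c \<bullet> x = c \<bullet> y" if X: "exposed_face c X = X" and xy: "x \<in> X" "y \<in> X" for X x y
      proof -
        have "x \<in> exposed_face c X" "y \<in> exposed_face c X"
          using xy by (simp_all only: X)
        then show ?thesis
          using xy by (simp add: exposed_face_def order_antisym)
      qed
      have orth: "orthogonal c w" if "w \<in> D" for w
      proof -
        from that consider x y where "w = x - y" "x \<in> P" "y \<in> P" | x y where "w = x - y" "x \<in> Q" "y \<in> Q"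
          by (auto simp: D_def)
        then show ?thesis
        proof cases
          case 1
          then show ?thesis
            using const[OF *(1) 1(2,3)] by (simp add: orthogonal_def inner_diff_right)
        next
          case 2
          then show ?thesis
            using const[OF *(2) 2(2,3)] by (simp add: orthogonal_def inner_diff_right)
        qed
      qed
      have "c \<in> span D"
        using c by (simp add: L_def)
      then have "orthogonal c c"
        by (rule orthogonal_to_span) (rule orth)
      then show False
        using c by (simp add: orthogonal_self)
    qed
    moreover have "aff_dim (exposed_face c X) \<le> aff_dim X" for X :: "(real^'n) set"
      by (intro aff_dim_subset exposed_face_subset)
    moreover have "aff_dim (exposed_face c X) < aff_dim X" if "convex X" "exposed_face c X \<noteq> X"
      for X :: "(real^'n) set"
      using that by (intro face_of_aff_dim_lt exposed_face_face_of)
    ultimately have "aff_dim (exposed_face c P) + aff_dim (exposed_face c Q) < aff_dim P + aff_dim Q"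
      using P(3) Q(3) by (meson add_le_less_mono add_less_le_mono)
    then show "nat (aff_dim (exposed_face c P) + aff_dim (exposed_face c Q)) < nat (aff_dim P + aff_dim Q)"
      using aff_dim_nonneg[OF exposed_face_nonempty[OF P(4,2)], of c]
        aff_dim_nonneg[OF exposed_face_nonempty[OF Q(4,2)], of c] by simp
    show "lattice_count (exposed_face c P) y = lattice_count (exposed_face c Q) y" for y
      by (rule lattice_count_exposed_face[OF P(4,3) Q(4,3) eq])
  qed (simp_all add: polytope_exposed_face exposed_face_nonempty P Q)
  consider "dim L = 0" | "dim L = 1" | "dim L \<ge> 2"
    by linarith
  then show ?case
  proof cases
    case 1
    then have L0: "L \<subseteq> {0}"
      by simp
    obtain p q where pq: "p \<in> P" "q \<in> Q"
      using P(2) Q(2) by blast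
    have Psing: "P = {p}"
      using pq(1) dirP[of _ p] L0 by fastforce
    have Qsing: "Q = {q}"
      using pq(2) dirQ[of _ q] L0 by fastforce
    \<comment> \<open>Both sets are single points. As 0 is counted for \<open>P\<close> at
      \<open>p\<close>, some lattice point \<open>z\<close> is counted for \<open>Q\<close> there,
      which forces \<open>z + p = q\<close>.\<close>
    have "0 \<in> {z \<in> lattice_points. z + p \<in> P}"
      using pq by simp
    then have "lattice_count P p \<noteq> 0"
      unfolding lattice_count_def
      using finite_lattice_translate[OF compact_imp_bounded[OF P(4)], of p]
      by (metis card_eq_0_iff empty_iff)
    then have "lattice_count Q p \<noteq> 0"
      by (simp add: eq)
    then obtain z where z: "z \<in> lattice_points" "z + p = q"
      unfolding lattice_count_def Qsing by (metis (mono_tags, lifting) card.empty empty_Collect_eq singletonD)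
    then have "P = translate Q (- z)"
      by (auto simp: Psing Qsing translate_def)
    then show ?thesis
      using lattice_points_uminus[OF z(1)] by blast
  next
    case 2
    then have "\<not> L \<subseteq> {0}"
      using dim_eq_0[of L] by simp
    then obtain e where e: "e \<in> L" "e \<noteq> 0"
      by blast
    then have span_e: "L = span {e}"
      using 2 L by (intro subspace_dim_equal[symmetric]) (auto intro: span_minimal[THEN subsetD])
    obtain u where u: "u \<in> lattice_points" "exposed_face e P = translate (exposed_face e Q) u"
      using faces[of e] e by blast
    have "P \<subseteq> translate Q u \<or> translate Q u \<subseteq> P"
    proof (rule collinear_common_exposed_face[where e = e])
      show "exposed_face e P = exposed_face e (translate Q u)"
        by (simp add: exposed_face_translate u(2))
    qed (use P Q dirP dirT in \<open>auto simp: compact_translate convex_translate span_e\<close>)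
    then show ?thesis
      by (rule done_if_comparable[OF u(1)])
  next
    case 3
    define f where "f c = (SOME u. u \<in> lattice_points \<and> exposed_face c P = translate (exposed_face c Q) u)" for c
    have f: "f c \<in> lattice_points" "exposed_face c P = translate (exposed_face c Q) (f c)"
      if "c \<in> L - {0}" for c
    proof -
      have "\<exists>u. u \<in> lattice_points \<and> exposed_face c P = translate (exposed_face c Q) u"
        using faces[OF that] by blast
      from someI_ex[OF this] show "f c \<in> lattice_points"
        "exposed_face c P = translate (exposed_face c Q) (f c)"
        by (simp_all add: f_def)
    qed
    \<comment> \<open>For \<open>c'\<close> near \<open>c\<close>, the faces for \<open>c'\<close>
      are faces of those for \<open>c\<close>, so translation by \<open>f c\<close> matches them as
      well; uniqueness of the translation gives \<open>f c = f c'\<close>.\<close>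
    have local: "\<forall>\<^sub>F c' in at c within L - {0}. f c = f c'" if c: "c \<in> L - {0}" for c
    proof -
      have "\<forall>\<^sub>F c' in at c within L - {0}. exposed_face c' P \<subseteq> exposed_face c P \<and> exposed_face c' Q \<subseteq> exposed_face c Q"
        using eventually_conj[OF eventually_exposed_face_subset[OF P(1), of c]
            eventually_exposed_face_subset[OF Q(1), of c]]
        by (rule filter_leD[OF at_within_le_nhds])
      moreover have "\<forall>\<^sub>F c' in at c within L - {0}. c' \<in> L - {0}"
        by (simp add: eventually_at_filter)
      ultimately show ?thesis
      proof eventually_elim
        case (elim c')
        have "translate (exposed_face c' Q) (f c') = exposed_face c' P"
          using f(2)[OF elim(2)] by simp
        also have "\<dots> = exposed_face c' (exposed_face c P)"
          using elim(1) P by (simp add: exposed_face_antimono)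
        also have "\<dots> = translate (exposed_face c' (exposed_face c Q)) (f c)"
          by (simp add: f(2)[OF c] exposed_face_translate)
        also have "exposed_face c' (exposed_face c Q) = exposed_face c' Q"
          using elim(1) Q by (simp add: exposed_face_antimono)
        finally show ?case
          using translate_unique[of "exposed_face c' Q" "f c'" "f c"]
            polytope_imp_compact[OF polytope_exposed_face[OF Q(1)]] exposed_face_nonempty[OF Q(4,2)]
          by simp
      qed
    qed
    \<comment> \<open>Dimension at least 2 enters here: a punctured line would be disconnected, and
      \<open>f\<close> could differ on its two halves.\<close>
    have "connected (L - {0})"
      using 3 L by (intro connected_punctured_convex) (auto simp: subspace_imp_convex aff_dim_subspace)
    then have f_const: "f c = f c'" if "c \<in> L - {0}" "c' \<in> L - {0}" for c c'
      using connected_local_const[of "L - {0}" c c' f] that local by blast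
    have "L \<noteq> {0}"
      using 3 by auto
    then obtain c0 where c0: "c0 \<in> L - {0}"
      using L subspace_0 by blast
    have "P \<subseteq> translate Q (f c0)"
    proof (rule subset_if_exposed_faces_eq[OF P(4,2) _ _ L \<open>L \<noteq> {0}\<close> dirP dirT])
      show "exposed_face c P = exposed_face c (translate Q (f c0))" if "c \<in> L - {0}" for c
        using f(2)[OF that] f_const[OF that c0] by (simp add: exposed_face_translate)
    qed (use Q in \<open>auto simp: compact_imp_closed compact_translate convex_translate\<close>)
    then show ?thesis
      using done_if_comparable[OF f(1)[OF c0]] by blast
  qed
qed

section \<open>From Ehrhart counts of rational translates to the conclusion\<close>

lemma rational_polytope_imp_polytope: "rational_polytope P \<Longrightarrow> polytope P"
  by (auto simp: rational_polytope_def polytope_def)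

theorem theorem1p4:
  fixes P Q :: "(real^'n) set"
  assumes "rational_polytope P" and "full_dim P"
      and "rational_polytope Q" and "full_dim Q"
      and "\<forall>v \<in> rational_points. \<forall>t::nat. ehr (translate P v) t = ehr (translate Q v) t"
  shows "\<exists>u \<in> lattice_points. P = translate Q u"
proof (rule polytope_determined_by_lattice_count)
  show P: "polytope P" and Q: "polytope Q"
    using assms by (simp_all add: rational_polytope_imp_polytope)
  \<comment> \<open>The empty set has affine dimension -1.\<close>
  show "P \<noteq> {}" "Q \<noteq> {}"
    using assms(2,4) by (auto simp: full_dim_def)
  \<comment> \<open>The hypothesis is taken at \<open>t = 1\<close> and at \<open>- v\<close>, since
    translating a set by \<open>- v\<close> amounts to counting at \<open>v\<close>.\<close>
  have rat: "lattice_count P v = lattice_count Q v" if v: "v \<in> rational_points" for v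
  proof -
    have "- v \<in> rational_points"
      using v by (simp add: rational_points_def)
    then show ?thesis
      using assms(5) ehr_translate_1[of P "- v"] ehr_translate_1[of Q "- v"] by simp
  qed
  show "lattice_count P y = lattice_count Q y" for y
    using lattice_count_le_if_rational[OF assms(1) polytope_imp_compact[OF Q]]
      lattice_count_le_if_rational[OF assms(3) polytope_imp_compact[OF P]] rat
    by (intro order_antisym) auto
qed

end
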